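(* Let $X$ be a functionally Hausdorff topological space and let $Y$ be a topological space that contains two non-empty open subsets with disjoint closures. Assume that $X$ is zero-dimensional or $Y$ is path-connected. If $X$ contains an injective meager-convergent sequence $(x_n)_{n\in\omega}$, then the function space $C_p(X,Y)$ is meager.
   Context: A space $X$ is functionally Hausdorff if for any distinct $x,y\in X$ there is a continuous $\lambda:X\to[0,1]$ with $\lambda(x)\neq\lambda(y)$. Zero-dimensional means having a base of clopen sets. $C_p(X,Y)$ is the space of continuous functions $X\to Y$ with the topology of pointwise convergence. A space is meager if it is a countable union of nowhere dense subsets of itself. A filter $\mathcal F$ on $\omega$ (a proper filter of subsets of $\omega$) is meager if it is a meager (first category) subset of the power-set $\mathcal P(\omega)=2^\omega$ with its usual compact metrizable topology. For a filter $\mathcal F$ on $\omega$, a sequence $(x_n)_{n\in\omega}$ in $X$ $\mathcal F$-converges to $x_\infty\in X$ if for each neighborhood $O$ of $x_\infty$ the set $\{n\in\omega:x_n\in O\}$ belongs to $\mathcal F$. A sequence is meager-convergent if it $\mathcal F$-converges to some point of $X$ for some meager filter $\mathcal F$ on $\omega$. A sequence is injective if $x_n\neq x_m$ for all $n\neq m$. *)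

theory Defs
  imports "HOL-Analysis.Analysis"
begin

definition functionally_Hausdorff_space :: "'a topology \<Rightarrow> bool" where
  "functionally_Hausdorff_space X \<longleftrightarrow>
     (\<forall>x\<in>topspace X. \<forall>y\<in>topspace X. x \<noteq> y \<longrightarrow>
        (\<exists>f. continuous_map X (top_of_set {0..1::real}) f \<and> f x \<noteq> f y))"

definition zero_dimensional_space :: "'a topology \<Rightarrow> bool" where
  "zero_dimensional_space X \<longleftrightarrow>
     (\<exists>\<B>. (\<forall>B\<in>\<B>. openin X B \<and> closedin X B) \<and>
          (\<forall>U. openin X U \<longrightarrow> (\<exists>\<V>\<subseteq>\<B>. U = \<Union>\<V>)))"

definition nowhere_dense_in :: "'a topology \<Rightarrow> 'a set \<Rightarrow> bool" where
  "nowhere_dense_in X S \<longleftrightarrow> S \<subseteq> topspace X \<and> X interior_of (X closure_of S) = {}"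

definition meager_in :: "'a topology \<Rightarrow> 'a set \<Rightarrow> bool" where
  "meager_in X S \<longleftrightarrow> (\<exists>\<N>. countable \<N> \<and> (\<forall>N\<in>\<N>. nowhere_dense_in X N) \<and> S = \<Union>\<N>)"

definition meager_space :: "'a topology \<Rightarrow> bool" where
  "meager_space X \<longleftrightarrow> meager_in X (topspace X)"

text \<open>The topology of pointwise convergence. As usual for \<^const>\<open>product_topology\<close>, a function on
  \<^term>\<open>topspace X\<close> is represented by its extension that is \<^const>\<open>undefined\<close> elsewhere,
  so every continuous function on the space is represented exactly once.\<close>

definition Cp :: "'a topology \<Rightarrow> 'b topology \<Rightarrow> ('a \<Rightarrow> 'b) topology" where
  "Cp X Y = subtopology (product_topology (\<lambda>_. Y) (topspace X)) {f. continuous_map X Y f}"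

definition cantor_topology :: "(nat \<Rightarrow> bool) topology" where
  "cantor_topology = product_topology (\<lambda>_. discrete_topology UNIV) UNIV"

text \<open>Sets of natural numbers are identified with their characteristic functions, so a filter,
  viewed as a subset of the power set, is the set of predicates that hold eventually.
  The type \<^typ>\<open>nat filter\<close> contains the improper filter \<^term>\<open>bot\<close>, which is excluded here.
  Filters are not required to contain the cofinite sets.\<close>

definition meager_filter :: "nat filter \<Rightarrow> bool" where
  "meager_filter F \<longleftrightarrow> F \<noteq> bot \<and> meager_in cantor_topology {P. eventually P F}"

definition meager_convergent :: "'a topology \<Rightarrow> (nat \<Rightarrow> 'a) \<Rightarrow> bool" where
  "meager_convergent X x \<longleftrightarrow>
     range x \<subseteq> topspace X \<and> (\<exists>F l. meager_filter F \<and> limitin X x l F)"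

end

theory Submission
  imports Defs
begin

text \<open>By Talagrand's characterisation, a meager filter comes with consecutive finite intervals
  of natural numbers such that each of its members meets all but finitely many of them. Let
  \<open>U\<close> and \<open>V\<close> be the given open sets of \<open>Y\<close> and let \<open>l\<close> be the limit of the sequence. For a
  continuous \<open>f\<close> the point \<open>f l\<close> lies outside the closure of \<open>U\<close> or outside that of \<open>V\<close>, so in
  almost every interval there is an \<open>n\<close> such that \<open>f (x n)\<close> avoids that closure. Thus the
  function space is a countable union of sets defined by the condition that from some interval
  on such an \<open>n\<close> always exists. Each of these is nowhere dense: a basic open set constrains
  only finitely many points, by injectivity some late interval is disjoint from these, and
  continuous functions can be prescribed arbitrarily on finite sets, in particular with all
  values on that interval in \<open>U\<close> (or \<open>V\<close>).\<close>

section \<open>Nowhere dense sets\<close>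

text \<open>Removing the closure of \<open>N\<close> from \<open>U\<close> gives the smaller open
  set; conversely, an open set that misses \<open>N\<close> misses its closure. Both directions
  serve below: one to build patterns in the Cantor space, the other to prove nowhere density in the
  function space.\<close>

lemma nowhere_dense_in_iff_disjoint_open:
  "nowhere_dense_in X N \<longleftrightarrow> N \<subseteq> topspace X \<and>
     (\<forall>U. openin X U \<and> U \<noteq> {} \<longrightarrow> (\<exists>W. openin X W \<and> W \<noteq> {} \<and> W \<subseteq> U \<and> W \<inter> N = {}))"
  (is "_ \<longleftrightarrow> _ \<and> ?R")
proof -
  have "?R \<longleftrightarrow> X interior_of (X closure_of N) = {}" if N: "N \<subseteq> topspace X"
  proof
    assume R: ?R
    show "X interior_of (X closure_of N) = {}"
    proof (rule ccontr)
      assume "X interior_of (X closure_of N) \<noteq> {}"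
      then obtain W where W: "openin X W" "W \<noteq> {}" "W \<subseteq> X interior_of (X closure_of N)"
          "W \<inter> N = {}"
        using R openin_interior_of by metis
      then have "W \<inter> X closure_of N = {}"
        by (simp add: openin_Int_closure_of_eq_empty)
      with W show False
        using interior_of_subset by fast
    qed
  next
    assume E: "X interior_of (X closure_of N) = {}"
    show ?R
    proof (intro allI impI)
      fix U assume U: "openin X U \<and> U \<noteq> {}"
      let ?W = "U - X closure_of N"
      have "?W \<noteq> {}"
        using U E unfolding interior_of_eq_empty by blast
      moreover have "openin X ?W"
        using U by (simp add: openin_diff)
      moreover have "?W \<inter> N = {}"
        using closure_of_subset[OF N] by blast
      ultimately show "\<exists>W. openin X W \<and> W \<noteq> {} \<and> W \<subseteq> U \<and> W \<inter> N = {}"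
        by blast
    qed
  qed
  then show ?thesis
    unfolding nowhere_dense_in_def by blast
qed

lemma nowhere_dense_in_disjoint_open:
  assumes "nowhere_dense_in X N" "openin X U" "U \<noteq> {}"
  shows "\<exists>W. openin X W \<and> W \<noteq> {} \<and> W \<subseteq> U \<and> W \<inter> N = {}"
  using assms by (simp add: nowhere_dense_in_iff_disjoint_open)

section \<open>Meager filters\<close>

lemma openin_cantor_cylinder: "openin cantor_topology {Q. \<forall>i<n. Q i = P i}"
proof -
  have "openin (product_topology (\<lambda>_. discrete_topology UNIV) UNIV)
          (Pi\<^sub>E UNIV (\<lambda>i::nat. if i < n then {P i :: bool} else UNIV))"
    by (rule product_topology_basis) (auto intro: finite_subset[of _ "{..<n}"])
  moreover have "Pi\<^sub>E UNIV (\<lambda>i. if i < n then {P i} else UNIV) = {Q. \<forall>i<n. Q i = P i}"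
    by (auto simp: PiE_def Pi_def split: if_splits)
  ultimately show ?thesis
    unfolding cantor_topology_def by simp
qed

lemma openin_cantor_contains_cylinder:
  assumes "openin cantor_topology U" "P \<in> U"
  obtains n where "{Q. \<forall>i<n. Q i = P i} \<subseteq> U"
proof -
  obtain A where A: "P \<in> Pi\<^sub>E UNIV A" "finite {i. A i \<noteq> UNIV}" "Pi\<^sub>E UNIV A \<subseteq> U"
    using product_topology_open_contains_basis[OF assms[unfolded cantor_topology_def]] by auto
  obtain n where n: "\<forall>i\<in>{i. A i \<noteq> UNIV}. i < n"
    using A(2)[unfolded finite_nat_set_iff_bounded] by (elim exE)
  have "{Q. \<forall>i<n. Q i = P i} \<subseteq> Pi\<^sub>E UNIV A"
  proof
    fix Q assume Q: "Q \<in> {Q. \<forall>i<n. Q i = P i}"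
    have "Q i \<in> A i" for i
      using A(1) n Q by (cases "A i = UNIV") (auto simp: PiE_iff)
    then show "Q \<in> Pi\<^sub>E UNIV A"
      by auto
  qed
  from this A(3) have "{Q. \<forall>i<n. Q i = P i} \<subseteq> U"
    by (rule order_trans)
  then show thesis
    by (rule that)
qed

text \<open>A pair \<open>q\<close> consists of a prefix, read below \<open>n\<close>, and a nowhere
  dense set. The common pattern \<open>s\<close> on \<open>{n..<m}\<close> is lengthened one pair at
  a time, and lengthening preserves what it already avoids.\<close>

lemma nowhere_dense_cantor_avoid_finite:
  assumes "finite \<Q>" "\<And>q. q \<in> \<Q> \<Longrightarrow> nowhere_dense_in cantor_topology (snd q)"
  shows "\<exists>m s. n < m \<and>
    (\<forall>q\<in>\<Q>. \<forall>P. (\<forall>i<n. P i = fst q i) \<longrightarrow> (\<forall>i\<in>{n..<m}. P i = s i) \<longrightarrow> P \<notin> snd q)"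
  using assms
proof (induction \<Q> rule: finite_induct)
  case empty
  then show ?case by auto
next
  case (insert q \<Q>)
  have "\<exists>m s. n < m \<and>
    (\<forall>q\<in>\<Q>. \<forall>P. (\<forall>i<n. P i = fst q i) \<longrightarrow> (\<forall>i\<in>{n..<m}. P i = s i) \<longrightarrow> P \<notin> snd q)"
    by (rule insert.IH) (simp add: insert.prems)
  then obtain m s where "n < m" and
    ms: "\<forall>q\<in>\<Q>. \<forall>P. (\<forall>i<n. P i = fst q i) \<longrightarrow> (\<forall>i\<in>{n..<m}. P i = s i) \<longrightarrow> P \<notin> snd q"
    by (elim exE conjE)
  \<comment> \<open>The new prefix continued by the old pattern determines a cylinder of length
    \<open>m\<close>. A point \<open>Q\<close> of it, with a whole cylinder around \<open>Q\<close>
    missing \<open>snd q\<close>, supplies the longer pattern.\<close>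
  let ?P = "\<lambda>i. if i < n then fst q i else s i"
  let ?U = "{Q. \<forall>i<m. Q i = ?P i}"
  have "?P \<in> ?U" by simp
  then have U: "?U \<noteq> {}" by (metis empty_iff)
  have nd: "nowhere_dense_in cantor_topology (snd q)"
    using insert.prems by simp
  obtain W where W: "openin cantor_topology W" "W \<noteq> {}" "W \<subseteq> ?U" "W \<inter> snd q = {}"
    using nowhere_dense_in_disjoint_open[OF nd openin_cantor_cylinder U] by (elim exE conjE)
  then obtain Q where Q: "Q \<in> W" by (meson ex_in_conv)
  obtain k where k: "{Q'. \<forall>i<k. Q' i = Q i} \<subseteq> W"
    by (rule openin_cantor_contains_cylinder[OF W(1) Q])
  have Qm: "Q i = ?P i" if "i < m" for i
    using subsetD[OF W(3) Q] that by simp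
  let ?m = "max m k"
  have "P \<notin> snd q'"
    if q': "q' \<in> insert q \<Q>" and Pn: "\<forall>i<n. P i = fst q' i" and Pm: "\<forall>i\<in>{n..<?m}. P i = Q i"
    for q' P
  proof (cases "q' = q")
    case True
    have "P i = Q i" if "i < k" for i
      using that Qm[of i] True Pn Pm \<open>n < m\<close> by (cases "i < n") auto
    then have "P \<in> W" using subsetD[OF k, of P] by simp
    then show ?thesis using W(4) True by (metis IntI empty_iff)
  next
    case False
    have "\<forall>i\<in>{n..<m}. P i = s i"
      using Pm Qm by auto
    then show ?thesis
      using ms[rule_format, of q' P] q' Pn False by simp
  qed
  moreover have "n < ?m" using \<open>n < m\<close> by simp
  ultimately show ?case by (intro exI[of _ ?m] exI[of _ Q]) simp
qed

text \<open>Only finitely many prefixes of length \<open>n\<close> exist, so one pattern can be made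
  to work after all of them, whatever \<open>P\<close> does below \<open>n\<close>.\<close>

lemma nowhere_dense_cantor_avoid:
  assumes "finite \<N>" "\<And>N. N \<in> \<N> \<Longrightarrow> nowhere_dense_in cantor_topology N"
  obtains m s where "n < m" "\<And>P N. \<forall>i\<in>{n..<m}. P i = s i \<Longrightarrow> N \<in> \<N> \<Longrightarrow> P \<notin> N"
proof -
  let ?\<Q> = "(\<lambda>A i. i \<in> A) ` Pow {..<n} \<times> \<N>"
  have "finite ?\<Q>" using assms(1) by simp
  moreover have "nowhere_dense_in cantor_topology (snd q)" if "q \<in> ?\<Q>" for q
    using assms(2) that by auto
  ultimately have "\<exists>m s. n < m \<and>
      (\<forall>q\<in>?\<Q>. \<forall>P. (\<forall>i<n. P i = fst q i) \<longrightarrow> (\<forall>i\<in>{n..<m}. P i = s i) \<longrightarrow> P \<notin> snd q)"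
    by (rule nowhere_dense_cantor_avoid_finite)
  then obtain m s where "n < m" and
    ms: "\<forall>q\<in>?\<Q>. \<forall>P. (\<forall>i<n. P i = fst q i) \<longrightarrow> (\<forall>i\<in>{n..<m}. P i = s i) \<longrightarrow> P \<notin> snd q"
    by (elim exE conjE)
  have "P \<notin> N" if P: "\<forall>i\<in>{n..<m}. P i = s i" and N: "N \<in> \<N>" for P N
  proof -
    \<comment> \<open>The prefixes are coded by subsets of \<open>{..<n}\<close>; the one used here
      is \<open>P\<close> cut off at \<open>n\<close>.\<close>
    have q: "((\<lambda>i. i \<in> {i. i < n \<and> P i}), N) \<in> ?\<Q>"
      using N by blast
    show ?thesis
      using ms[rule_format, OF q, of P] P by simp
  qed
  then show thesis using that \<open>n < m\<close> by blast
qed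

lemma disjoint_family_consecutive_intervals:
  fixes r :: "nat \<Rightarrow> nat"
  assumes "strict_mono r"
  shows "disjoint_family (\<lambda>k. {r k..<r (Suc k)})"
proof -
  have "{r a..<r (Suc a)} \<inter> {r b..<r (Suc b)} = {}" if "a < b" for a b
    using strict_mono_leD[OF assms, of "Suc a" b] that by auto
  then show ?thesis
    unfolding disjoint_family_on_def by (metis Int_commute linorder_neqE_nat)
qed

text \<open>The intervals carry patterns that force a set out of more and more of the nowhere dense
  sets; a member missing infinitely many intervals could be enlarged, within the filter, so as
  to follow the pattern on all of these.\<close>

lemma meager_filter_intervals:
  assumes "meager_filter F"
  obtains r :: "nat \<Rightarrow> nat" where "strict_mono r"
    "\<And>P. eventually P F \<Longrightarrow> \<forall>\<^sub>F k in sequentially. \<exists>n\<in>{r k..<r (Suc k)}. P n"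
proof -
  have "meager_in cantor_topology {P. eventually P F}"
    using assms by (simp add: meager_filter_def)
  then obtain \<N> where \<N>: "countable \<N>" "\<forall>N\<in>\<N>. nowhere_dense_in cantor_topology N"
      "{P. eventually P F} = \<Union>\<N>"
    unfolding meager_in_def by (elim exE conjE)
  have "(\<lambda>_. True) \<in> {P. eventually P F}" by simp
  then have "\<N> \<noteq> {}" unfolding \<N>(3) by (intro notI) simp
  define N where "N = from_nat_into \<N>"
  have nd: "nowhere_dense_in cantor_topology (N j)" for j
    unfolding N_def by (rule bspec[OF \<N>(2) from_nat_into[OF \<open>\<N> \<noteq> {}\<close>]])
  have FN: "eventually P F \<longleftrightarrow> (\<exists>j. P \<in> N j)" for P
  proof -
    have "range N = \<N>"
      unfolding N_def using \<N>(1) \<open>\<N> \<noteq> {}\<close> by (rule range_from_nat_into[rotated])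
    then have "{P. eventually P F} = (\<Union>j. N j)" using \<N>(3) by simp
    from eqset_imp_iff[OF this, of P] show ?thesis by simp
  qed
  have "\<exists>m s. n < m \<and> (\<forall>P. (\<forall>i\<in>{n..<m}. P i = s i) \<longrightarrow> (\<forall>j\<le>k. P \<notin> N j))" for n k
  proof -
    obtain m s where "n < m"
      and s: "\<And>P M. \<forall>i\<in>{n..<m}. P i = s i \<Longrightarrow> M \<in> N ` {..k} \<Longrightarrow> P \<notin> M"
      by (rule nowhere_dense_cantor_avoid[of "N ` {..k}" n]) (use nd in auto)
    have "\<forall>P. (\<forall>i\<in>{n..<m}. P i = s i) \<longrightarrow> (\<forall>j\<le>k. P \<notin> N j)"
      using s by simp
    with \<open>n < m\<close> show ?thesis by (intro exI conjI)
  qed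
  then obtain m s where m: "\<And>n k. n < m n k"
    and s: "\<And>n k P j. \<forall>i\<in>{n..<m n k}. P i = s n k i \<Longrightarrow> j \<le> k \<Longrightarrow> P \<notin> N j"
    by metis
  \<comment> \<open>Interval \<open>k\<close> starts at \<open>r k\<close> and is long enough to
    carry a pattern excluding \<open>N 0\<close> to \<open>N k\<close>.\<close>
  define r where "r = rec_nat 0 (\<lambda>k n. m n k)"
  have rS: "r (Suc k) = m (r k) k" for k
    unfolding r_def by simp
  have mono: "strict_mono r"
    by (simp add: strict_mono_Suc_iff rS m)
  define I where "I k = {r k..<r (Suc k)}" for k
  have disj: "k = k'" if "i \<in> I k" "i \<in> I k'" for i k k'
    using disjoint_family_consecutive_intervals[OF mono] that
    unfolding disjoint_family_on_def I_def by blast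
  have "\<forall>\<^sub>F k in sequentially. \<exists>n\<in>I k. P n" if P: "eventually P F" for P
  proof (rule ccontr)
    assume "\<not> ?thesis"
    then have inf: "\<exists>k\<ge>j. \<forall>n\<in>I k. \<not> P n" for j
      unfolding eventually_sequentially by blast
    define P' where "P' i \<longleftrightarrow> P i \<or> (\<exists>k. i \<in> I k \<and> (\<forall>n\<in>I k. \<not> P n) \<and> s (r k) k i)" for i
    have "eventually P' F"
      using P by (rule eventually_mono) (simp add: P'_def)
    then obtain j where j: "P' \<in> N j" using FN by blast
    obtain k where k: "j \<le> k" "\<forall>n\<in>I k. \<not> P n" using inf by blast
    \<comment> \<open>\<open>P\<close> fails throughout \<open>I k\<close>, and by disjointness no
      other interval contributes to \<open>P'\<close> there.\<close>
    have "P' i = s (r k) k i" if "i \<in> I k" for i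
      unfolding P'_def using that k(2) disj by blast
    then have "P' \<notin> N j"
      using s[of "r k" k P' j] k(1) unfolding I_def rS by blast
    with j show False by blast
  qed
  then show thesis
    using that mono unfolding I_def by blast
qed

section \<open>Prescribing continuous functions on finite sets\<close>

text \<open>For each \<open>q\<close> in \<open>S\<close>, a real function separating
  \<open>p\<close> from \<open>q\<close> gives an open set around \<open>p\<close> without
  \<open>q\<close>, and a clopen basic set fits between. Finitely many of these are
  intersected.\<close>

lemma zero_dimensional_clopen_avoiding:
  assumes "functionally_Hausdorff_space X" "zero_dimensional_space X"
    and "finite S" "S \<subseteq> topspace X" "p \<in> topspace X" "p \<notin> S"
  shows "\<exists>C. openin X C \<and> closedin X C \<and> p \<in> C \<and> C \<inter> S = {}"
  using assms(3,4,6)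
proof (induction S rule: finite_induct)
  case empty
  show ?case using assms(5) by blast
next
  case (insert q S)
  obtain C where C: "openin X C" "closedin X C" "p \<in> C" "C \<inter> S = {}"
    using insert by auto
  have "q \<in> topspace X" "p \<noteq> q"
    using insert.prems by auto
  then obtain f where f: "continuous_map X (top_of_set {0..1::real}) f" "f p \<noteq> f q"
    using assms(1,5) unfolding functionally_Hausdorff_space_def by meson
  have f': "continuous_map X euclideanreal f"
    using f(1) continuous_map_in_subtopology by blast
  have U: "openin X {z \<in> topspace X. f z \<in> - {f q}}"
    by (rule openin_continuous_map_preimage[OF f']) (simp add: open_Compl)
  obtain \<B> where \<B>: "\<forall>B\<in>\<B>. openin X B \<and> closedin X B"
     "\<forall>U. openin X U \<longrightarrow> (\<exists>\<V>\<subseteq>\<B>. U = \<Union>\<V>)"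
    using assms(2) unfolding zero_dimensional_space_def by (elim exE conjE)
  obtain \<V> where \<V>: "\<V> \<subseteq> \<B>" "{z \<in> topspace X. f z \<in> - {f q}} = \<Union>\<V>"
    using \<B>(2)[rule_format, OF U] by (elim exE conjE)
  have "p \<in> \<Union>\<V>"
    unfolding \<V>(2)[symmetric] using f(2) assms(5) by simp
  then obtain D where D: "D \<in> \<V>" "p \<in> D" by blast
  then have "D \<in> \<B>" using \<V>(1) by blast
  have "q \<notin> \<Union>\<V>"
    unfolding \<V>(2)[symmetric] by simp
  then have "q \<notin> D" using D(1) by blast
  have "openin X (C \<inter> D)" "closedin X (C \<inter> D)"
    using C(1,2) \<open>D \<in> \<B>\<close> \<B>(1) by (simp_all add: openin_Int closedin_Int)
  moreover have "p \<in> C \<inter> D" "(C \<inter> D) \<inter> insert q S = {}"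
    using C(3,4) D(2) \<open>q \<notin> D\<close> by auto
  ultimately show ?case by blast
qed

text \<open>A new value is imposed by making the function constant on a clopen set around the new
  point that avoids the earlier ones; its empty frontier keeps the function continuous.\<close>

lemma zero_dimensional_interpolation:
  assumes "functionally_Hausdorff_space X" "zero_dimensional_space X"
    and "finite S" "S \<subseteq> topspace X" "g ` S \<subseteq> topspace Y" "topspace Y \<noteq> {}"
  shows "\<exists>f. continuous_map X Y f \<and> (\<forall>s\<in>S. f s = g s)"
  using assms(3-5)
proof (induction S rule: finite_induct)
  case empty
  then show ?case
    using assms(6) by (metis all_not_in_conv continuous_map_const)
next
  case (insert p S)
  obtain f where f: "continuous_map X Y f" "\<forall>s\<in>S. f s = g s"
    using insert by auto
  obtain C where C: "openin X C" "closedin X C" "p \<in> C" "C \<inter> S = {}"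
    using zero_dimensional_clopen_avoiding[OF assms(1,2), of S p] insert by auto
  have "X frontier_of C = {}"
    using C by (simp add: frontier_of_eq_empty openin_subset)
  then have "continuous_map X Y (\<lambda>z. if z \<in> C then g p else f z)"
    using insert.prems f(1)
    by (intro continuous_map_cases)
       (auto simp: continuous_map_from_subtopology)
  moreover have "\<forall>s\<in>insert p S. (if s \<in> C then g p else f s) = g s"
    using C f(2) by auto
  ultimately show ?case by blast
qed

text \<open>If \<open>\<mu>\<close> separates a further pair of points, then so does \<open>h + t \<mu>\<close> for all but finitely many
  real \<open>t\<close>, and only finitely many \<open>t\<close> spoil a pair already separated by \<open>h\<close>.\<close>

lemma functionally_Hausdorff_separate_pairs:
  assumes "functionally_Hausdorff_space X" "finite T"
    and "\<And>a b. (a, b) \<in> T \<Longrightarrow> a \<in> topspace X \<and> b \<in> topspace X \<and> a \<noteq> b"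
  shows "\<exists>h. continuous_map X euclideanreal h \<and> (\<forall>(a, b)\<in>T. h a \<noteq> h b)"
  using assms(2,3)
proof (induction T rule: finite_induct)
  case empty
  have "continuous_map X euclideanreal (\<lambda>_. 0)" by simp
  then show ?case by blast
next
  case (insert q T)
  obtain a b where q: "q = (a, b)" by (cases q)
  obtain h where h: "continuous_map X euclideanreal h" "\<forall>(a, b)\<in>T. h a \<noteq> h b"
    using insert by auto
  obtain \<mu> where "continuous_map X (top_of_set {0..1::real}) \<mu>" and ab: "\<mu> a \<noteq> \<mu> b"
    using assms(1) insert.prems[of a b] q unfolding functionally_Hausdorff_space_def by auto
  then have \<mu>: "continuous_map X euclideanreal \<mu>"
    using continuous_map_in_subtopology by blast
  \<comment> \<open>Where \<open>\<mu> c = \<mu> d\<close>, division by zero contributes the value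
    0, whose exclusion is harmless.\<close>
  let ?bad = "(\<lambda>(c, d). (h d - h c) / (\<mu> c - \<mu> d)) ` insert q T"
  have "finite ?bad" using insert.hyps by simp
  then obtain t where t: "t \<notin> ?bad"
    using ex_new_if_finite infinite_UNIV_char_0 by blast
  let ?h = "\<lambda>z. h z + t * \<mu> z"
  have "continuous_map X euclideanreal ?h"
    using h(1) \<mu> by (intro continuous_intros)
  moreover have "?h c \<noteq> ?h d" if cd: "(c, d) \<in> insert q T" for c d
  proof
    assume eq: "?h c = ?h d"
    show False
    proof (cases "\<mu> c = \<mu> d")
      case True
      with eq have "h c = h d" by simp
      \<comment> \<open>Since \<open>\<mu>\<close> separates \<open>a\<close> and \<open>b\<close>,
        the pair \<open>(c, d)\<close> is an old one, already separated by \<open>h\<close>.\<close>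
      with True cd ab q h(2) show False by auto
    next
      case False
      have "t * (\<mu> c - \<mu> d) = h d - h c"
        using eq by (simp add: algebra_simps)
      with False have "t = (h d - h c) / (\<mu> c - \<mu> d)"
        by (simp add: field_simps)
      with t cd show False by force
    qed
  qed
  ultimately show ?case by blast
qed

text \<open>Points are added in increasing order: the curve so far is kept up to some
  \<open>c\<close> below the new point \<open>b\<close>, and a path in \<open>Y\<close> then leads
  to the value required at \<open>b\<close>.\<close>

lemma path_connected_curve_through:
  fixes S :: "real set"
  assumes "path_connected_space Y" "topspace Y \<noteq> {}" "finite S" "g ` S \<subseteq> topspace Y"
  shows "\<exists>\<gamma>. continuous_map euclideanreal Y \<gamma> \<and> (\<forall>s\<in>S. \<gamma> s = g s)"
  using assms(3,4)
proof (induction S rule: finite_linorder_max_induct)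
  case empty
  then show ?case
    using assms(2) by (metis all_not_in_conv continuous_map_const)
next
  case (insert b A)
  obtain \<gamma> where \<gamma>: "continuous_map euclideanreal Y \<gamma>" "\<forall>s\<in>A. \<gamma> s = g s"
    using insert by auto
  obtain c where c: "c < b" "\<forall>a\<in>A. a \<le> c"
  proof (cases "A = {}")
    case True
    then show thesis using that[of "b - 1"] by auto
  next
    case False
    then show thesis using that[of "Max A"] insert.hyps by auto
  qed
  have "\<gamma> c \<in> topspace Y"
    using \<gamma>(1) continuous_map_funspace by fastforce
  moreover have "g b \<in> topspace Y"
    using insert.prems by blast
  ultimately obtain p where p: "pathin Y p" "p 0 = \<gamma> c" "p 1 = g b"
    using assms(1) unfolding path_connected_space_def by blast
  \<comment> \<open>This clamped affine map is 0 up to \<open>c\<close> and 1 from \<open>b\<close>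
    on, so the path starts at \<open>\<gamma> c\<close>, where the two pieces are glued.\<close>
  let ?\<tau> = "\<lambda>t. max 0 (min 1 ((t - c) / (b - c)))"
  have "continuous_on UNIV ?\<tau>"
    using c(1) by (intro continuous_intros) auto
  then have "continuous_map euclideanreal (top_of_set {0..1}) ?\<tau>"
    by (auto simp: continuous_map_in_subtopology)
  then have "continuous_map euclideanreal Y (p \<circ> ?\<tau>)"
    using p(1) unfolding pathin_def by (rule continuous_map_compose)
  then have "continuous_map euclideanreal Y (\<lambda>t. if t \<le> c then \<gamma> t else (p \<circ> ?\<tau>) t)"
    using \<gamma>(1) p(2)
    by (intro continuous_map_cases_le continuous_map_from_subtopology) (auto simp: o_def)
  moreover have "\<forall>s\<in>insert b A. (if s \<le> c then \<gamma> s else (p \<circ> ?\<tau>) s) = g s"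
    using c \<gamma>(2) p(3) by auto
  ultimately show ?case by blast
qed

lemma path_connected_interpolation:
  assumes "functionally_Hausdorff_space X" "path_connected_space Y"
    and "finite S" "S \<subseteq> topspace X" "g ` S \<subseteq> topspace Y" "topspace Y \<noteq> {}"
  shows "\<exists>f. continuous_map X Y f \<and> (\<forall>s\<in>S. f s = g s)"
proof -
  let ?T = "{(a, b). a \<in> S \<and> b \<in> S \<and> a \<noteq> b}"
  have "finite ?T"
    using assms(3) by (auto intro: finite_subset[of _ "S \<times> S"])
  then obtain h where h: "continuous_map X euclideanreal h" "\<forall>(a, b)\<in>?T. h a \<noteq> h b"
    using functionally_Hausdorff_separate_pairs[OF assms(1), of ?T] assms(4) by blast
  have inj: "inj_on h S"
    using h(2) by (auto simp: inj_on_def)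
  have "(g \<circ> inv_into S h) ` h ` S \<subseteq> topspace Y"
    using assms(5) inj by (auto simp: image_subset_iff)
  then obtain \<gamma> where \<gamma>: "continuous_map euclideanreal Y \<gamma>"
     "\<forall>t\<in>h ` S. \<gamma> t = (g \<circ> inv_into S h) t"
    using path_connected_curve_through[OF assms(2,6), of "h ` S" "g \<circ> inv_into S h"] assms(3)
    by blast
  have "continuous_map X Y (\<gamma> \<circ> h)"
    using h(1) \<gamma>(1) by (rule continuous_map_compose)
  moreover have "\<forall>s\<in>S. (\<gamma> \<circ> h) s = g s"
    using \<gamma>(2) inj by simp
  ultimately show ?thesis by blast
qed

section \<open>The function space\<close>

lemma topspace_Cp: "f \<in> topspace (Cp X Y) \<longleftrightarrow> f \<in> extensional (topspace X) \<and> continuous_map X Y f"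
  unfolding Cp_def by (auto simp: PiE_def continuous_map_def)

lemma openin_Cp_eval:
  assumes "openin Y U" "p \<in> topspace X"
  shows "openin (Cp X Y) {f \<in> topspace (Cp X Y). f p \<in> U}"
  unfolding Cp_def
  by (rule openin_continuous_map_preimage[OF _ assms(1)])
     (intro continuous_map_from_subtopology continuous_map_product_projection assms(2))

text \<open>Interpolation enters as a hypothesis so that the zero-dimensional and the path-connected
  case share this argument.\<close>

lemma Cp_nowhere_dense:
  fixes J :: "nat \<Rightarrow> 'a set"
  assumes interp: "\<And>S g. finite S \<Longrightarrow> S \<subseteq> topspace X \<Longrightarrow> g ` S \<subseteq> topspace Y \<Longrightarrow>
      \<exists>f. continuous_map X Y f \<and> (\<forall>s\<in>S. f s = g s)"
    and J: "\<And>k. finite (J k)" "\<And>k. J k \<subseteq> topspace X" "disjoint_family J"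
    and U: "openin Y U" "U \<noteq> {}"
  shows "nowhere_dense_in (Cp X Y) {f \<in> topspace (Cp X Y). \<forall>k\<ge>m. \<exists>p\<in>J k. f p \<notin> U}"
    (is "nowhere_dense_in _ ?N")
  unfolding nowhere_dense_in_iff_disjoint_open
proof (intro conjI allI impI)
  show "?N \<subseteq> topspace (Cp X Y)" by blast
next
  fix W assume W: "openin (Cp X Y) W \<and> W \<noteq> {}"
  then obtain g where g: "g \<in> W" by blast
  obtain W0 where W0: "openin (product_topology (\<lambda>_. Y) (topspace X)) W0"
      "W = W0 \<inter> {f. continuous_map X Y f}"
    using W unfolding Cp_def openin_subtopology by blast
  obtain A where A: "g \<in> Pi\<^sub>E (topspace X) A" "finite {i. A i \<noteq> topspace Y}"
      "Pi\<^sub>E (topspace X) A \<subseteq> W0"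
    using product_topology_open_contains_basis[OF W0(1), of g] g W0(2) by blast
  define S where "S = topspace X \<inter> {i. A i \<noteq> topspace Y}"
  have finS: "finite S" unfolding S_def using A(2) by blast
  \<comment> \<open>If every \<open>J k\<close> with \<open>k \<ge> m\<close> met \<open>S\<close>,
    choosing a point from each would inject an infinite set into the finite
    \<open>S\<close>.\<close>
  obtain k where k: "m \<le> k" "J k \<inter> S = {}"
  proof (rule ccontr)
    assume "\<not> thesis"
    then have *: "\<forall>k\<ge>m. \<exists>p. p \<in> J k \<and> p \<in> S" using that by blast
    then obtain p where p: "\<And>k. k \<ge> m \<Longrightarrow> p k \<in> J k \<and> p k \<in> S" by metis
    have "inj_on p {m..}"
    proof (rule inj_onI)
      fix i j assume "i \<in> {m..}" "j \<in> {m..}" "p i = p j"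
      then have "p i \<in> J i \<inter> J j" using p[of i] p[of j] by auto
      then show "i = j" using J(3) unfolding disjoint_family_on_def by blast
    qed
    moreover have "p ` {m..} \<subseteq> S" using p by auto
    ultimately have "finite {m..}"
      using finS by (meson finite_imageD finite_subset)
    then show False using infinite_Ici by blast
  qed
  obtain u where u: "u \<in> U" using U(2) by blast
  have gY: "g p \<in> topspace Y" if "p \<in> topspace X" for p
    using g W0(2) that by (auto simp: continuous_map_def)
  have uY: "u \<in> topspace Y" using u U(1) openin_subset by blast
  have "(\<lambda>s. if s \<in> J k then u else g s) ` (S \<union> J k) \<subseteq> topspace Y"
    using gY uY by (auto simp: S_def)
  moreover have "S \<union> J k \<subseteq> topspace X" using J(2) by (auto simp: S_def)
  moreover have "finite (S \<union> J k)" using finS J(1) by blast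
  ultimately obtain f where f: "continuous_map X Y f"
      "\<forall>s\<in>S \<union> J k. f s = (if s \<in> J k then u else g s)"
    by (elim interp[THEN exE] conjE)
  \<comment> \<open>Points of the function space must be \<open>undefined\<close> off
    \<open>topspace X\<close>.\<close>
  define f' where "f' = restrict f (topspace X)"
  have f': "continuous_map X Y f'" "f' \<in> extensional (topspace X)"
    unfolding f'_def using f(1) by (auto intro: continuous_map_eq)
  have "f' p \<in> A p" if p: "p \<in> topspace X" for p
  proof (cases "p \<in> S")
    case True
    then have "f' p = g p" using f(2) k(2) p unfolding f'_def by auto
    then show ?thesis using A(1) p by auto
  next
    case False
    then have "A p = topspace Y" using p unfolding S_def by blast
    then show ?thesis using f'(1) p by (auto simp: continuous_map_def)
  qed
  then have "f' \<in> Pi\<^sub>E (topspace X) A"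
    using f'(2) by (simp add: PiE_iff)
  then have f'W: "f' \<in> W"
    using A(3) f'(1) W0(2) by blast
  let ?W = "W \<inter> (\<Inter>p\<in>J k. {f \<in> topspace (Cp X Y). f p \<in> U}) \<inter> topspace (Cp X Y)"
  have "openin (Cp X Y) ?W"
  \<comment> \<open>An intersection over the empty index set is the whole type, so openness needs a
    separate case.\<close>
  proof (cases "J k = {}")
    case True
    then show ?thesis using W by (simp add: openin_Int)
  next
    case False
    then have "openin (Cp X Y) (\<Inter>p\<in>J k. {f \<in> topspace (Cp X Y). f p \<in> U})"
      using J(1,2) U(1) by (intro openin_INT2 openin_Cp_eval) auto
    then show ?thesis using W by (intro openin_Int) auto
  qed
  moreover have "f' \<in> ?W"
    using f'W f' f(2) u J(2)[of k] unfolding f'_def by (auto simp: topspace_Cp)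
  then have "?W \<noteq> {}" by blast
  moreover have "?W \<inter> ?N = {}" using k(1) by auto
  moreover have "?W \<subseteq> W" by blast
  ultimately show "\<exists>W'. openin (Cp X Y) W' \<and> W' \<noteq> {} \<and> W' \<subseteq> W \<and> W' \<inter> ?N = {}" by meson
qed

theorem theorem1:
  fixes X :: "'a topology" and Y :: "'b topology" and x :: "nat \<Rightarrow> 'a"
  assumes "functionally_Hausdorff_space X"
    and "\<exists>U V. openin Y U \<and> openin Y V \<and> U \<noteq> {} \<and> V \<noteq> {} \<and>
               Y closure_of U \<inter> Y closure_of V = {}"
    and "zero_dimensional_space X \<or> path_connected_space Y"
    and "inj x" and "meager_convergent X x"
  shows "meager_space (Cp X Y)"
proof -
  obtain U V where UV: "openin Y U" "openin Y V" "U \<noteq> {}" "V \<noteq> {}"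
      "Y closure_of U \<inter> Y closure_of V = {}"
    using assms(2) by blast
  have "topspace Y \<noteq> {}" using UV openin_subset by blast
  have interp: "\<exists>f. continuous_map X Y f \<and> (\<forall>s\<in>S. f s = g s)"
    if "finite S" "S \<subseteq> topspace X" "g ` S \<subseteq> topspace Y" for S g
    using assms(3)
  proof
    assume "zero_dimensional_space X"
    then show ?thesis
      by (rule zero_dimensional_interpolation[OF assms(1) _ that \<open>topspace Y \<noteq> {}\<close>])
  next
    assume "path_connected_space Y"
    then show ?thesis
      by (rule path_connected_interpolation[OF assms(1) _ that \<open>topspace Y \<noteq> {}\<close>])
  qed
  obtain F l where F: "meager_filter F" "limitin X x l F" and xX: "range x \<subseteq> topspace X"
    using assms(5) unfolding meager_convergent_def by (elim exE conjE)
  obtain r :: "nat \<Rightarrow> nat" where r: "strict_mono r"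
    "\<And>P. eventually P F \<Longrightarrow> \<forall>\<^sub>F k in sequentially. \<exists>n\<in>{r k..<r (Suc k)}. P n"
    by (rule meager_filter_intervals[OF F(1)]) (rule that)
  define J where "J k = x ` {r k..<r (Suc k)}" for k
  have J: "finite (J k)" "J k \<subseteq> topspace X" for k
    unfolding J_def using xX by auto
  \<comment> \<open>Injectivity of the sequence is what carries disjointness from the intervals to
    their images.\<close>
  have Jdisj: "disjoint_family J"
    using disjoint_family_consecutive_intervals[OF r(1)] assms(4)
    unfolding J_def disjoint_family_on_def by (metis image_Int image_empty)
  define N where "N W m = {f \<in> topspace (Cp X Y). \<forall>k\<ge>m. \<exists>p\<in>J k. f p \<notin> W}" for W m
  have nd: "nowhere_dense_in (Cp X Y) (N W m)" if "openin Y W" "W \<noteq> {}" for W m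
    unfolding N_def using interp J Jdisj that by (intro Cp_nowhere_dense) auto
  have cover: "\<exists>m. f \<in> N W m"
    if W: "openin Y W" and f: "f \<in> topspace (Cp X Y)" "f l \<notin> Y closure_of W" for W f
  proof -
    have cf: "continuous_map X Y f" using f(1) topspace_Cp by blast
    let ?O = "{z \<in> topspace X. f z \<in> topspace Y - Y closure_of W}"
    have "openin X ?O"
      by (rule openin_continuous_map_preimage[OF cf]) (simp add: openin_diff)
    moreover have "l \<in> ?O"
      using F(2) f(2) cf by (auto simp: limitin_def continuous_map_def)
    ultimately have "\<forall>\<^sub>F n in F. x n \<in> ?O"
      by (rule limitinD[OF F(2)])
    then obtain m where m: "\<forall>k\<ge>m. \<exists>n\<in>{r k..<r (Suc k)}. x n \<in> ?O"
      by (elim r(2)[unfolded eventually_sequentially, THEN exE])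
    have "\<exists>p\<in>J k. f p \<notin> W" if k: "k \<ge> m" for k
    proof -
      obtain n where n: "n \<in> {r k..<r (Suc k)}" "x n \<in> ?O"
        using m k by blast
      then have "f (x n) \<notin> W"
        using closure_of_subset[OF openin_subset[OF W]] by blast
      then show ?thesis
        unfolding J_def using n(1) by blast
    qed
    then show ?thesis using f(1) unfolding N_def by blast
  qed
  have "topspace (Cp X Y) = \<Union>(range (N U) \<union> range (N V))"
  proof
    show "topspace (Cp X Y) \<subseteq> \<Union>(range (N U) \<union> range (N V))"
    proof
      fix f assume f: "f \<in> topspace (Cp X Y)"
      have "f l \<notin> Y closure_of U \<or> f l \<notin> Y closure_of V"
        using UV(5) by blast
      then have "(\<exists>m. f \<in> N U m) \<or> (\<exists>m. f \<in> N V m)"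
        using cover[OF UV(1) f] cover[OF UV(2) f] by blast
      then show "f \<in> \<Union>(range (N U) \<union> range (N V))" by blast
    qed
  qed (auto simp: N_def)
  moreover have "countable (range (N U) \<union> range (N V))" by simp
  moreover have "\<forall>M\<in>range (N U) \<union> range (N V). nowhere_dense_in (Cp X Y) M"
    using nd UV by blast
  ultimately show ?thesis
    unfolding meager_space_def meager_in_def by (intro exI conjI)
qed

end
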